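(* Let $q=(q_1,\dots,q_n)\in(\mathbb{R}^3)^n$, $q_i=(x_i,y_i,z_i)$, together with positive masses $m=(m_1,\dots,m_n)$, be a normalized central configuration satisfying $y_{n-1}=z_{n-1}=z_{n-2}=0$. If $$x_{n-1}-x_n\neq 0,\qquad x_{n-1}\neq 0,\qquad y_{n-2}\neq 0,\qquad \det\begin{bmatrix} y_{n-2}-y_n & y_{n-1}-y_n\\ x_{n-2}-x_n & x_{n-1}-x_n\end{bmatrix}\neq 0,$$ then $(q,m)$ is a non-degenerate normalized central configuration if and only if it is a non-degenerate solution of the reduced system $\mathcal{RS}$ (in dimension $d=3$).
   Context: Let $n\ge 3$, masses $m_i>0$, positions $q_i=(x_i,y_i,z_i)\in\mathbb{R}^3$ pairwise distinct, $r_{ij}=|q_i-q_j|$. Define $F_i(q_1,\dots,q_n)=q_i-\sum_{j\ne i}\frac{m_j}{r_{ij}^3}(q_i-q_j)$ for $i=1,\dots,n$ and $F=(F_1,\dots,F_n)$. A normalized central configuration (nCC) is $(q,m)$ with $F(q)=0$ (this forces $\sum_i m_iq_i=0$). An nCC is non-degenerate if $\operatorname{rank} DF(q)=3n-\dim(\mathcal{SO}(3)q)$, where $\mathcal{SO}(3)q=\{(Rq_1,\dots,Rq_n): R\in \mathcal{SO}(3)\}$; the orbit dimension is $2$ for collinear configurations and $3$ otherwise. Center of mass reduction: $q_n(q_1,\dots,q_{n-1})=-\frac1{m_n}\sum_{i=1}^{n-1}m_iq_i$, and $F^{\mathrm{red}}_i(q_1,\dots,q_{n-1})=F_i(q_1,\dots,q_{n-1},q_n(q_1,\dots,q_{n-1}))$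 for $i=1,\dots,n-1$, with components $F^{\mathrm{red}}_i=(F^{\mathrm{red}}_{i,x},F^{\mathrm{red}}_{i,y},F^{\mathrm{red}}_{i,z})$. Reduced system $\mathcal{RS}$ for $d=3$: the $3n-6$ equations $F^{\mathrm{red}}_i=0$ ($i=1,\dots,n-3$), $F^{\mathrm{red}}_{n-2,x}=0$, $F^{\mathrm{red}}_{n-2,y}=0$, $F^{\mathrm{red}}_{n-1,x}=0$ in the $3n-6$ real unknowns $(q_1,\dots,q_{n-3},x_{n-2},y_{n-2},x_{n-1})$, where $z_{n-2}=y_{n-1}=z_{n-1}=0$ is imposed. A configuration $(q,m)$ is a solution of $\mathcal{RS}$ if these equations hold, $z_{n-2}=y_{n-1}=z_{n-1}=0$ and $q_n=q_n(q_1,\dots,q_{n-1})$. It is a non-degenerate solution of $\mathcal{RS}$ if the $(3n-6)\times(3n-6)$ Jacobian matrix of the left-hand sides with respect to these unknowns is invertible at it. *)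

theory Defs
  imports "HOL-Analysis.Analysis" "Jordan_Normal_Form.DL_Rank"
begin

(* In this theory "$" selects a component of a point of real^3; the matrices of size 3n and
   3n-6 are those of Jordan_Normal_Form. *)
no_notation vec_index (infixl "$" 100)

(* A configuration is a function q with q 1, ..., q n the positions and m 1, ..., m n the masses;
   values outside {1..n} are never used. The coordinates (x,y,z) of q i are
   (q i $ 1, q i $ 2, q i $ 3). *)

definition configuration :: "nat \<Rightarrow> (nat \<Rightarrow> real) \<Rightarrow> (nat \<Rightarrow> real^3) \<Rightarrow> bool" where
  "configuration n m q \<longleftrightarrow> (\<forall>i\<in>{1..n}. m i > 0) \<and> inj_on q {1..n}"

definition F :: "nat \<Rightarrow> (nat \<Rightarrow> real) \<Rightarrow> (nat \<Rightarrow> real^3) \<Rightarrow> nat \<Rightarrow> real^3" where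
  "F n m q i = q i - (\<Sum>j\<in>{1..n} - {i}. (m j / norm (q i - q j) ^ 3) *\<^sub>R (q i - q j))"

definition nCC :: "nat \<Rightarrow> (nat \<Rightarrow> real) \<Rightarrow> (nat \<Rightarrow> real^3) \<Rightarrow> bool" where
  "nCC n m q \<longleftrightarrow> configuration n m q \<and> (\<forall>i\<in>{1..n}. F n m q i = 0)"

(* The label (i,k) stands for the k-th coordinate of the i-th body; it indexes both scalar
   unknowns and scalar equations. *)

definition partial :: "((nat \<Rightarrow> real^3) \<Rightarrow> real) \<Rightarrow> nat \<times> 3 \<Rightarrow> (nat \<Rightarrow> real^3) \<Rightarrow> real" where
  "partial f v q = (case v of (i, k) \<Rightarrow> deriv (\<lambda>t. f (q(i := q i + t *\<^sub>R axis k 1))) 0)"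

definition jacobian_mat ::
  "((nat \<Rightarrow> real^3) \<Rightarrow> nat \<Rightarrow> real^3) \<Rightarrow> (nat \<times> 3) list \<Rightarrow> (nat \<times> 3) list
    \<Rightarrow> (nat \<Rightarrow> real^3) \<Rightarrow> real mat" where
  "jacobian_mat G eqs vars q =
     Matrix.mat (length eqs) (length vars)
       (\<lambda>(r, c). partial (\<lambda>p. G p (fst (eqs ! r)) $ snd (eqs ! r)) (vars ! c) q)"

definition coords :: "nat \<Rightarrow> (nat \<times> 3) list" where
  "coords n = concat (map (\<lambda>i. [(i, 1), (i, 2), (i, 3)]) [1..<n + 1])"

definition DF :: "nat \<Rightarrow> (nat \<Rightarrow> real) \<Rightarrow> (nat \<Rightarrow> real^3) \<Rightarrow> real mat" where
  "DF n m q = jacobian_mat (F n m) (coords n) (coords n) q"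

definition SO3_orbit :: "nat \<Rightarrow> (nat \<Rightarrow> real^3) \<Rightarrow> (nat \<Rightarrow> real^3) set" where
  "SO3_orbit n q = {p. \<exists>R::real^3^3. rotation_matrix R \<and> (\<forall>i\<in>{1..n}. p i = R *v q i)}"

(* The dimension of the orbit, a homogeneous submanifold of R^(3n), is the dimension of its tangent
   space at q, i.e. of the space of velocities at q of the curves in the orbit through q. *)

definition orbit_velocities :: "nat \<Rightarrow> (nat \<Rightarrow> real^3) \<Rightarrow> real Matrix.vec set" where
  "orbit_velocities n q =
     {Matrix.vec (3 * n) (\<lambda>r. v (fst (coords n ! r)) $ snd (coords n ! r)) | v.
       \<exists>\<gamma>. (\<forall>t::real. \<gamma> t \<in> SO3_orbit n q)
         \<and> (\<forall>i\<in>{1..n}. \<gamma> 0 i = q i \<and> ((\<lambda>t. \<gamma> t i) has_vector_derivative v i) (at 0))}"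

definition (in vec_space) span_dim :: "'a Matrix.vec set \<Rightarrow> nat" where
  "span_dim S = vectorspace.dim class_ring (span_vs S)"

definition SO3_orbit_dim :: "nat \<Rightarrow> (nat \<Rightarrow> real^3) \<Rightarrow> nat" where
  "SO3_orbit_dim n q = vec_space.span_dim (3 * n) (orbit_velocities n q)"

definition nondegenerate_nCC :: "nat \<Rightarrow> (nat \<Rightarrow> real) \<Rightarrow> (nat \<Rightarrow> real^3) \<Rightarrow> bool" where
  "nondegenerate_nCC n m q \<longleftrightarrow>
     nCC n m q \<and> vec_space.rank (3 * n) (DF n m q) = 3 * n - SO3_orbit_dim n q"

definition com_position :: "nat \<Rightarrow> (nat \<Rightarrow> real) \<Rightarrow> (nat \<Rightarrow> real^3) \<Rightarrow> real^3" where
  "com_position n m q = - (1 / m n) *\<^sub>R (\<Sum>i\<in>{1..n - 1}. m i *\<^sub>R q i)"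

(* The value q n is overwritten, so Fred is a function of q 1, ..., q (n-1) only. *)
definition Fred :: "nat \<Rightarrow> (nat \<Rightarrow> real) \<Rightarrow> (nat \<Rightarrow> real^3) \<Rightarrow> nat \<Rightarrow> real^3" where
  "Fred n m q i = F n m (q(n := com_position n m q)) i"

(* The equations and the unknowns of the reduced system carry the same 3n-6 labels:
   all (i,k) with i \<le> n-3, then (n-2,x), (n-2,y), (n-1,x). *)
definition RS_coords :: "nat \<Rightarrow> (nat \<times> 3) list" where
  "RS_coords n = coords (n - 3) @ [(n - 2, 1), (n - 2, 2), (n - 1, 1)]"

definition RS_solution :: "nat \<Rightarrow> (nat \<Rightarrow> real) \<Rightarrow> (nat \<Rightarrow> real^3) \<Rightarrow> bool" where
  "RS_solution n m q \<longleftrightarrow> configuration n m q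
     \<and> (\<forall>(i, k)\<in>set (RS_coords n). Fred n m q i $ k = 0)
     \<and> q (n - 2) $ 3 = 0 \<and> q (n - 1) $ 2 = 0 \<and> q (n - 1) $ 3 = 0
     \<and> q n = com_position n m q"

(* The variables z_(n-2), y_(n-1), z_(n-1) are not among the labels, so they stay
   at their imposed value 0 when differentiating at a solution. *)
definition RS_jacobian :: "nat \<Rightarrow> (nat \<Rightarrow> real) \<Rightarrow> (nat \<Rightarrow> real^3) \<Rightarrow> real mat" where
  "RS_jacobian n m q = jacobian_mat (Fred n m) (RS_coords n) (RS_coords n) q"

definition nondegenerate_RS_solution ::
  "nat \<Rightarrow> (nat \<Rightarrow> real) \<Rightarrow> (nat \<Rightarrow> real^3) \<Rightarrow> bool" where
  "nondegenerate_RS_solution n m q \<longleftrightarrow>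
     RS_solution n m q \<and> invertible_mat (RS_jacobian n m q)"

end

theory Submission
  imports Defs
begin

unbundle cross3_syntax

text \<open>
  Both notions of nondegeneracy are statements about the kernel of the linear map
  \<open>w \<mapsto> F_deriv n m q w\<close>, the derivative of \<open>F\<close> at the central configuration \<open>q\<close>.

  \<^item> Since \<open>F\<close> commutes with rotations and \<open>F q = 0\<close>, every infinitesimal rotation \<open>i \<mapsto> \<omega> \<times> q i\<close> lies in the
    kernel. These displacements form the tangent space of the orbit, so by rank-nullity \<open>q\<close> is
    nondegenerate iff they are the whole kernel (\<open>nondegenerate_nCC_iff\<close>).

  \<^item> The reduced Jacobian matrix is invertible iff no nonzero displacement with vanishing center of mass
    and with vanishing coordinates \<open>z (n - 2)\<close>, \<open>y (n - 1)\<close>, \<open>z (n - 1)\<close> satisfies the \<open>3 * n - 6\<close> linearised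
    equations of the reduced system (\<open>RS_jacobian_invertible_iff\<close>).

  Two facts connect these statements. First, the linearised equations that the reduced system drops
  follow from those it keeps. Indeed the derivative of \<open>F\<close> is symmetric for the mass-weighted inner product
  (\<open>F_deriv_symmetric\<close>); pairing it with translations and with infinitesimal rotations shows that
  the vectors \<open>m i *\<^sub>R F_deriv n m q w i\<close> have total force and total torque zero whenever the center of mass of \<open>w\<close>
  vanishes. If in addition the kept equations hold, the hypotheses \<open>x (n - 1) \<noteq> x n\<close> and on the determinant
  force the remaining components to be zero (\<open>balanced_forces_vanish\<close>). Conversely, kernel elements
  automatically have vanishing center of mass.

  Secondly, the conditions \<open>z (n - 2) = y (n - 1) = z (n - 1) = 0\<close> on a displacement define a complement of the
  infinitesimal rotations, because \<open>x (n - 1) \<noteq> 0\<close> and \<open>y (n - 2) \<noteq> 0\<close> (\<open>rotation_gauge_exists\<close> and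
  \<open>rotation_gauge_unique\<close>). So the kernel consists of infinitesimal rotations only iff it meets this
  complement only in zero.
\<close>

section \<open>Rank and kernel of square matrices\<close>

text \<open>Linearly independent subsets of the subspace have at most \<open>dim\<close> elements, so a largest one
  exists, and such a set is a basis.\<close>

lemma (in vectorspace) subspace_basis_exists:
  assumes fd: "fin_dim" and X: "subspace K X V"
  obtains B where "finite B" "B \<subseteq> X" "lin_indpt B" "vectorspace.basis K (vs X) B"
proof -
  interpret X: vectorspace K "vs X" by (rule subspace_is_vs[OF X])
  have sub: "submodule K X V" and XV: "X \<subseteq> carrier V"
    using X by (auto simp: subspace_def submodule_def)
  have li: "X.lin_dep A \<longleftrightarrow> lin_dep A" if "A \<subseteq> X" for A
    using span_li_not_depend(2)[OF that sub] .
  have "\<exists>B. finite B \<and> maximal B (\<lambda>S. S \<subseteq> carrier (vs X) \<and> X.lin_indpt S)"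
  proof (rule maximal_exists[where N = dim and B = "{}"])
    fix A assume "A \<subseteq> carrier (vs X) \<and> X.lin_indpt A"
    then have "A \<subseteq> carrier V" "lin_indpt A" using li[of A] XV by auto
    then show "finite A \<and> card A \<le> dim" using li_le_dim[OF fd] by auto
  qed (auto simp: X.lin_dep_def)
  then obtain B where B: "finite B" "maximal B (\<lambda>S. S \<subseteq> carrier (vs X) \<and> X.lin_indpt S)" by blast
  then have "B \<subseteq> X" "X.lin_indpt B" by (auto simp: maximal_def)
  with B li[of B] X.max_li_is_basis[OF B(2)] that show ?thesis by blast
qed

lemma (in vectorspace) subspace_dim_le:
  assumes fd: "fin_dim" and X: "subspace K X V"
  shows "vectorspace.dim K (vs X) \<le> dim"
    and "vectorspace.dim K (vs X) = dim \<longleftrightarrow> X = carrier V"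
proof -
  interpret X: vectorspace K "vs X" by (rule subspace_is_vs[OF X])
  have sub: "submodule K X V" and XV: "X \<subseteq> carrier V"
    using X by (auto simp: subspace_def submodule_def)
  obtain B where B: "finite B" "B \<subseteq> X" "lin_indpt B" "X.basis B"
    using subspace_basis_exists[OF fd X] by blast
  have BV: "B \<subseteq> carrier V" using B XV by auto
  have dB: "X.dim = card B" using X.dim_basis B by blast
  then show "X.dim \<le> dim" using li_le_dim(2)[OF fd BV B(3)] by simp
  show "X.dim = dim \<longleftrightarrow> X = carrier V"
  proof
    assume "X.dim = dim"
    then have "basis B" using dim_li_is_basis[OF fd B(1) BV B(3)] dB by simp
    then have "span B = carrier V" by (simp add: basis_def)
    moreover have "X.span B = X" using B(4) X.basis_def by simp
    ultimately show "X = carrier V" using span_li_not_depend(1)[OF B(2) sub] by simp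
  next
    assume "X = carrier V" then show "X.dim = dim" by simp
  qed
qed

text \<open>If \<open>S\<close> lies in the kernel, then so does its span, and by rank-nullity the rank equals
  \<open>n - span_dim S\<close> exactly when the span has the dimension of the kernel, that is, when it is the
  whole kernel.\<close>

lemma (in vec_space) rank_eq_iff_kernel_le_span:
  assumes A: "A \<in> carrier_mat n n" and S: "S \<subseteq> carrier_vec n" and AS: "\<And>s. s \<in> S \<Longrightarrow> A *\<^sub>v s = 0\<^sub>v n"
  shows "rank A = n - span_dim S \<longleftrightarrow> (\<forall>v\<in>carrier_vec n. A *\<^sub>v v = 0\<^sub>v n \<longrightarrow> v \<in> span S)"
proof -
  interpret T: linear_map class_ring V V "\<lambda>v. A *\<^sub>v v"
    by unfold_locales (use A in \<open>auto simp: mod_hom_def module_hom_def mult_add_distrib_mat_vec mult_mat_vec LinearCombinations.module_hom_def\<close>)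
  let ?K = "{v \<in> carrier_vec n. A *\<^sub>v v = 0\<^sub>v n}"
  have ker: "T.kerT = ?K" unfolding T.ker_def by simp
  \<comment> \<open>The rank is defined by the span of the columns, which is the image of the map.\<close>
  have im: "T.imT = span (set (cols A))"
    using col_space_eq[OF A] A unfolding T.im_def col_space_def by auto
  have K: "subspace class_ring ?K V" using T.kerT_is_subspace ker by simp
  have Ssub: "subspace class_ring (span S) V" using S span_is_subspace by simp
  have SK: "S \<subseteq> ?K" using S AS by auto
  have sub: "span S \<subseteq> ?K"
    using span_is_subset[OF SK] K unfolding subspace_def by simp
  interpret K: vectorspace class_ring "vs ?K" by (rule subspace_is_vs[OF K])
  have nested: "subspace class_ring (span S) (vs ?K)"
    using nested_subspaces[OF K Ssub sub] .
  obtain B where B: "finite B" "B \<subseteq> ?K" "K.basis B"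
    using subspace_basis_exists[OF fin_dim K] by blast
  have fdK: "K.fin_dim" using B K.basis_def K.fin_dim_def by auto
  have "rank A + K.dim = n"
    using T.rank_nullity[OF fin_dim] ker im dim_is_n by (simp add: rank_def)
  moreover have "K.dim \<le> n" using subspace_dim_le(1)[OF fin_dim K] dim_is_n by simp
  moreover have "span_dim S \<le> K.dim" "span_dim S = K.dim \<longleftrightarrow> span S = ?K"
    using K.subspace_dim_le[OF fdK nested] by (simp_all add: span_dim_def)
  ultimately have "rank A = n - span_dim S \<longleftrightarrow> span S = ?K" by linarith
  then show ?thesis using sub by blast
qed

lemma invertible_mat_iff_kernel_trivial:
  fixes A :: "'a::field mat"
  assumes A: "A \<in> carrier_mat n n"
  shows "invertible_mat A \<longleftrightarrow> (\<forall>v\<in>carrier_vec n. A *\<^sub>v v = 0\<^sub>v n \<longrightarrow> v = 0\<^sub>v n)"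
proof
  assume "invertible_mat A"
  then obtain C where "inverts_mat A C" "inverts_mat C A"
    unfolding invertible_mat_def by auto
  then have CA: "C * A = 1\<^sub>m (dim_row C)" and AC: "A * C = 1\<^sub>m n"
    using A by (auto simp: inverts_mat_def)
  then have "dim_row C = n" "dim_col C = n"
    using A by (metis carrier_matD(2) index_mult_mat(3) index_one_mat(3))+
  then have C: "C \<in> carrier_mat n n" by auto
  show "\<forall>v\<in>carrier_vec n. A *\<^sub>v v = 0\<^sub>v n \<longrightarrow> v = 0\<^sub>v n"
  proof (intro ballI impI)
    fix v assume v: "v \<in> carrier_vec n" and "A *\<^sub>v v = 0\<^sub>v n"
    then have "(C * A) *\<^sub>v v = C *\<^sub>v 0\<^sub>v n" using assoc_mult_mat_vec[OF C A v] by simp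
    moreover have "C * A = 1\<^sub>m n" using CA C by simp
    ultimately show "v = 0\<^sub>v n" using C v by auto
  qed
next
  assume triv: "\<forall>v\<in>carrier_vec n. A *\<^sub>v v = 0\<^sub>v n \<longrightarrow> v = 0\<^sub>v n"
  then have "Determinant.det A \<noteq> 0" using det_0_iff_vec_prod_zero_field[OF A] by blast
  from det_non_zero_imp_unit[OF A this, of "()"] obtain B where
    "B \<in> carrier_mat n n" "B * A = 1\<^sub>m n" "A * B = 1\<^sub>m n"
    by (auto simp: Units_def ring_mat_def)
  then show "invertible_mat A" using A unfolding invertible_mat_def inverts_mat_def by auto
qed

section \<open>The derivative of the central configuration map\<close>

text \<open>The derivative of the attraction \<open>d \<mapsto> d / norm d ^ 3\<close> at \<open>d\<close> in direction \<open>e\<close>. At \<open>d = 0\<close> the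
  convention \<open>x / 0 = 0\<close> makes it vanish, which lets sums over pairs of bodies include the diagonal.\<close>

definition attraction_deriv :: "real^3 \<Rightarrow> real^3 \<Rightarrow> real^3" where
  "attraction_deriv d e = (1 / norm d ^ 3) *\<^sub>R e - (3 * (d \<bullet> e) / norm d ^ 5) *\<^sub>R d"

lemma attraction_has_vector_derivative:
  fixes d e :: "real^3"
  assumes "d \<noteq> 0"
  shows "((\<lambda>t. (1 / norm (d + t *\<^sub>R e) ^ 3) *\<^sub>R (d + t *\<^sub>R e))
           has_vector_derivative attraction_deriv d e) (at 0)"
proof -
  let ?g = "\<lambda>t. d + t *\<^sub>R e"
  have g: "(?g has_vector_derivative e) (at 0)"
    by (auto intro!: derivative_eq_intros)
  have "((\<lambda>t. norm (?g t)) has_real_derivative (d \<bullet> e) / norm d) (at 0)"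
  proof -
    have "(norm has_derivative (\<lambda>h. h \<bullet> sgn d)) (at (?g 0))"
      using has_derivative_norm[OF assms] by simp
    from has_derivative_compose[OF g[unfolded has_vector_derivative_def] this] show ?thesis
      unfolding has_field_derivative_def
      by (rule has_derivative_eq_rhs) (simp add: fun_eq_iff sgn_div_norm inner_commute divide_inverse)
  qed
  then have "((\<lambda>t. 1 / norm (?g t) ^ 3) has_real_derivative - 3 * (d \<bullet> e) / norm d ^ 5) (at 0)"
    using assms
    by (auto intro!: derivative_eq_intros simp: field_simps power_numeral_reduce)
  from has_vector_derivative_scaleR[OF this g] show ?thesis
    using assms by (simp add: attraction_deriv_def algebra_simps)
qed

lemma attraction_deriv_linear:
  "attraction_deriv d (e + f) = attraction_deriv d e + attraction_deriv d f"
  "attraction_deriv d (c *\<^sub>R e) = c *\<^sub>R attraction_deriv d e"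
  "attraction_deriv d 0 = 0"
  by (simp_all add: attraction_deriv_def algebra_simps inner_add_right add_divide_distrib)

lemma attraction_deriv_zero_left: "attraction_deriv 0 e = 0"
  by (simp add: attraction_deriv_def)

lemma attraction_deriv_minus: "attraction_deriv (- d) (- e) = - attraction_deriv d e"
  by (simp add: attraction_deriv_def)

text \<open>The attraction is a gradient field, so its derivative is a symmetric matrix.\<close>

lemma attraction_deriv_self_adjoint: "attraction_deriv d e \<bullet> f = e \<bullet> attraction_deriv d f"
  by (simp add: attraction_deriv_def inner_diff_left inner_diff_right inner_commute)

text \<open>Euler's relation for a field that is homogeneous of degree \<open>-2\<close>.\<close>

lemma attraction_deriv_radial: "attraction_deriv d d = - (2 / norm d ^ 3) *\<^sub>R d"
proof (cases "d = 0")
  case False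
  then have "(d \<bullet> d) / norm d ^ 5 = 1 / norm d ^ 3"
    by (simp add: dot_square_norm field_simps power_numeral_reduce)
  then have "3 * (d \<bullet> d) / norm d ^ 5 = 3 / norm d ^ 3" by simp
  then have "attraction_deriv d d = (1 / norm d ^ 3 - 3 / norm d ^ 3) *\<^sub>R d"
    unfolding attraction_deriv_def by (metis scaleR_left_diff_distrib)
  also have "1 / norm d ^ 3 - 3 / norm d ^ 3 = - (2 / norm d ^ 3)" by simp
  finally show ?thesis .
qed (simp add: attraction_deriv_def)

lemma attraction_deriv_rotation: "attraction_deriv d (\<omega> \<times> d) = (1 / norm d ^ 3) *\<^sub>R (\<omega> \<times> d)"
  by (simp add: attraction_deriv_def dot_cross_self)

definition F_deriv :: "nat \<Rightarrow> (nat \<Rightarrow> real) \<Rightarrow> (nat \<Rightarrow> real^3) \<Rightarrow> (nat \<Rightarrow> real^3) \<Rightarrow> nat \<Rightarrow> real^3" where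
  "F_deriv n m q w i = w i - (\<Sum>j\<in>{1..n} - {i}. m j *\<^sub>R attraction_deriv (q i - q j) (w i - w j))"

lemma F_has_directional_derivative:
  assumes "inj_on q {1..n}" and i: "i \<in> {1..n}"
  shows "((\<lambda>t. F n m (\<lambda>j. q j + t *\<^sub>R w j) i) has_vector_derivative F_deriv n m q w i) (at 0)"
proof -
  have "((\<lambda>t. m j *\<^sub>R ((1 / norm ((q i - q j) + t *\<^sub>R (w i - w j)) ^ 3) *\<^sub>R ((q i - q j) + t *\<^sub>R (w i - w j))))
      has_vector_derivative m j *\<^sub>R attraction_deriv (q i - q j) (w i - w j)) (at 0)" if "j \<in> {1..n} - {i}" for j
  proof -
    have "q i - q j \<noteq> 0" using that i assms(1) by (auto dest: inj_onD)
    from attraction_has_vector_derivative[OF this] show ?thesis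
      using has_vector_derivative_scaleR[OF DERIV_const] by fastforce
  qed
  then have "((\<lambda>t. \<Sum>j\<in>{1..n} - {i}. m j *\<^sub>R ((1 / norm ((q i - q j) + t *\<^sub>R (w i - w j)) ^ 3) *\<^sub>R ((q i - q j) + t *\<^sub>R (w i - w j))))
      has_vector_derivative (\<Sum>j\<in>{1..n} - {i}. m j *\<^sub>R attraction_deriv (q i - q j) (w i - w j))) (at 0)"
    by (rule has_vector_derivative_sum)
  moreover have "((\<lambda>t. q i + t *\<^sub>R w i) has_vector_derivative w i) (at 0)"
    by (auto intro!: derivative_eq_intros)
  ultimately have "((\<lambda>t. (q i + t *\<^sub>R w i) - (\<Sum>j\<in>{1..n} - {i}. m j *\<^sub>R ((1 / norm ((q i - q j) + t *\<^sub>R (w i - w j)) ^ 3) *\<^sub>R ((q i - q j) + t *\<^sub>R (w i - w j)))))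
      has_vector_derivative F_deriv n m q w i) (at 0)"
    unfolding F_deriv_def by (rule has_vector_derivative_diff[rotated])
  moreover have "q i + t *\<^sub>R w i - (q j + t *\<^sub>R w j) = (q i - q j) + t *\<^sub>R (w i - w j)" for t j
    by (simp add: algebra_simps)
  ultimately show ?thesis unfolding F_def by (simp only: scaleR_scaleR times_divide_eq_right mult_1_right)
qed

lemma F_deriv_cong:
  assumes "\<And>j. j \<in> {1..n} \<Longrightarrow> w j = w' j" "i \<in> {1..n}"
  shows "F_deriv n m q w i = F_deriv n m q w' i"
  unfolding F_deriv_def using assms by (intro arg_cong2[where f = minus] sum.cong) auto

lemma F_deriv_add: "F_deriv n m q (\<lambda>j. u j + w j) i = F_deriv n m q u i + F_deriv n m q w i"
  unfolding F_deriv_def add_diff_add attraction_deriv_linear scaleR_add_right sum.distrib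
  by simp

lemma F_deriv_scaleR: "F_deriv n m q (\<lambda>j. c *\<^sub>R w j) i = c *\<^sub>R F_deriv n m q w i"
  unfolding F_deriv_def scaleR_diff_right[symmetric] attraction_deriv_linear
  by (simp add: scaleR_diff_right scaleR_sum_right mult.commute)

lemma F_deriv_translation: "F_deriv n m q (\<lambda>j. e) i = e"
  by (simp add: F_deriv_def attraction_deriv_linear)

lemma F_deriv_sum:
  assumes "finite C"
  shows "F_deriv n m q (\<lambda>j. \<Sum>c\<in>C. x c *\<^sub>R u c j) i = (\<Sum>c\<in>C. x c *\<^sub>R F_deriv n m q (u c) i)"
  using assms
  by (induction C rule: finite_induct) (simp_all add: F_deriv_add F_deriv_scaleR F_deriv_translation)

text \<open>The infinitesimal form of the equivariance of \<open>F\<close> under rotations: \<open>\<omega> \<times> d\<close> is orthogonal to \<open>d\<close>, so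
  only the first term of the derivative of the attraction survives. At a central configuration the
  infinitesimal rotations therefore lie in the kernel of the derivative.\<close>

lemma F_deriv_rotation: "F_deriv n m q (\<lambda>j. \<omega> \<times> q j) i = \<omega> \<times> F n m q i"
proof -
  have "\<omega> \<times> q i - \<omega> \<times> q j = \<omega> \<times> (q i - q j)" for j
    by (simp add: Cross3.right_diff_distrib)
  moreover have "\<omega> \<times> (\<Sum>j\<in>A. f j) = (\<Sum>j\<in>A. \<omega> \<times> f j)" for A :: "nat set" and f
    by (induction A rule: infinite_finite_induct) (simp_all add: cross_add_right)
  ultimately show ?thesis
    unfolding F_deriv_def F_def Cross3.right_diff_distrib[of _ "q i" "sum _ _"]
    by (simp only: attraction_deriv_rotation cross_mult_right scaleR_scaleR times_divide_eq_right mult_1_right)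
qed

lemma F_deriv_scaling: "F_deriv n m q q i = 3 *\<^sub>R q i - 2 *\<^sub>R F n m q i"
proof -
  have "(\<Sum>j\<in>{1..n} - {i}. m j *\<^sub>R attraction_deriv (q i - q j) (q i - q j))
      = - 2 *\<^sub>R (\<Sum>j\<in>{1..n} - {i}. (m j / norm (q i - q j) ^ 3) *\<^sub>R (q i - q j))"
    by (simp add: attraction_deriv_radial scaleR_sum_right sum_negf mult.commute)
  then show ?thesis
    by (simp add: F_deriv_def F_def scaleR_diff_right) (simp flip: scaleR_left_diff_distrib)
qed

text \<open>After weighting by the masses, \<open>F\<close> is the gradient of a function of the positions (half the moment of
  inertia plus the Newtonian potential), so its weighted derivative is a Hessian. The proof
  symmetrises the double sum over pairs of bodies, where Newton's third law gives a sign change.\<close>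

lemma F_deriv_symmetric:
  "(\<Sum>i\<in>{1..n}. m i * (F_deriv n m q u i \<bullet> w i)) = (\<Sum>i\<in>{1..n}. m i * (u i \<bullet> F_deriv n m q w i))"
proof -
  define S where "S = {1..n}"
  \<comment> \<open>The interaction part of the bilinear form; the rest is the mass-weighted inner product.\<close>
  define D where "D u w = (\<Sum>i\<in>S. \<Sum>j\<in>S. m i * m j * (attraction_deriv (q i - q j) (u i - u j) \<bullet> w i))" for u w
  have F: "(\<Sum>i\<in>S. m i * (F_deriv n m q u i \<bullet> w i)) = (\<Sum>i\<in>S. m i * (u i \<bullet> w i)) - D u w" for u w
  proof -
    have "F_deriv n m q u i = u i - (\<Sum>j\<in>S. m j *\<^sub>R attraction_deriv (q i - q j) (u i - u j))" if "i \<in> S" for i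
      using that unfolding F_deriv_def S_def by (simp add: sum_diff1 attraction_deriv_zero_left)
    then have "(\<Sum>i\<in>S. m i * (F_deriv n m q u i \<bullet> w i))
       = (\<Sum>i\<in>S. m i * (u i \<bullet> w i) - (\<Sum>j\<in>S. m i * m j * (attraction_deriv (q i - q j) (u i - u j) \<bullet> w i)))"
      by (intro sum.cong) (simp_all add: inner_diff_left inner_sum_left right_diff_distrib sum_distrib_left mult.assoc)
    then show ?thesis by (simp add: D_def sum_subtractf)
  qed
  have D: "2 * D u w = (\<Sum>i\<in>S. \<Sum>j\<in>S. m i * m j * (attraction_deriv (q i - q j) (u i - u j) \<bullet> (w i - w j)))" for u w
  proof -
    have "D u w = (\<Sum>i\<in>S. \<Sum>j\<in>S. m j * m i * (attraction_deriv (q j - q i) (u j - u i) \<bullet> w j))"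
      unfolding D_def by (rule sum.swap)
    also have "\<dots> = (\<Sum>i\<in>S. \<Sum>j\<in>S. - (m i * m j * (attraction_deriv (q i - q j) (u i - u j) \<bullet> w j)))"
    proof (intro sum.cong refl)
      fix i j
      have "attraction_deriv (q j - q i) (u j - u i) = - attraction_deriv (q i - q j) (u i - u j)"
        using attraction_deriv_minus[of "q i - q j" "u i - u j"] by simp
      then show "m j * m i * (attraction_deriv (q j - q i) (u j - u i) \<bullet> w j)
          = - (m i * m j * (attraction_deriv (q i - q j) (u i - u j) \<bullet> w j))" by simp
    qed
    finally have "2 * D u w = (\<Sum>i\<in>S. \<Sum>j\<in>S. m i * m j * (attraction_deriv (q i - q j) (u i - u j) \<bullet> w i)
         + - (m i * m j * (attraction_deriv (q i - q j) (u i - u j) \<bullet> w j)))"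
      unfolding sum.distrib by (simp add: D_def)
    then show ?thesis by (simp add: inner_diff_right right_diff_distrib)
  qed
  have "2 * D u w = 2 * D w u"
    unfolding D by (intro sum.cong refl) (metis attraction_deriv_self_adjoint inner_commute)
  then have "D u w = D w u" by simp
  then show ?thesis using F[of u w] F[of w u] by (simp add: S_def inner_commute)
qed

text \<open>Pair the symmetry of the derivative with a translation, which the derivative maps to itself.\<close>

lemma F_deriv_momentum: "(\<Sum>i\<in>{1..n}. m i *\<^sub>R F_deriv n m q w i) = (\<Sum>i\<in>{1..n}. m i *\<^sub>R w i)"
proof (rule vector_eq_rdot[THEN iffD1, rule_format])
  fix e
  show "(\<Sum>i\<in>{1..n}. m i *\<^sub>R F_deriv n m q w i) \<bullet> e = (\<Sum>i\<in>{1..n}. m i *\<^sub>R w i) \<bullet> e"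
    using F_deriv_symmetric[of m n q w "\<lambda>_. e"] by (simp add: F_deriv_translation inner_sum_left)
qed

text \<open>Pair the symmetry of the derivative with an infinitesimal rotation, which lies in the kernel.\<close>

lemma F_deriv_angular_momentum:
  assumes "\<And>i. i \<in> {1..n} \<Longrightarrow> F n m q i = 0"
  shows "(\<Sum>i\<in>{1..n}. m i *\<^sub>R (q i \<times> F_deriv n m q w i)) = 0"
proof (rule vector_eq_ldot[THEN iffD1, rule_format])
  fix \<omega>
  have "\<omega> \<bullet> (q i \<times> g) = g \<bullet> (\<omega> \<times> q i)" for i g
    by (simp add: cross3_simps)
  then show "\<omega> \<bullet> (\<Sum>i\<in>{1..n}. m i *\<^sub>R (q i \<times> F_deriv n m q w i)) = \<omega> \<bullet> 0"
    using F_deriv_symmetric[of m n q w "\<lambda>i. \<omega> \<times> q i"] assms by (simp add: F_deriv_rotation inner_sum_right)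
qed

text \<open>Differentiate along the scaling direction \<open>q\<close>: at a zero of \<open>F\<close> the derivative is \<open>3 q\<close>, while
  conservation of momentum says that its weighted sum equals that of \<open>q\<close>.\<close>

lemma nCC_center_of_mass:
  assumes "\<And>i. i \<in> {1..n} \<Longrightarrow> F n m q i = 0"
  shows "(\<Sum>i\<in>{1..n}. m i *\<^sub>R q i) = 0"
proof -
  have "(\<Sum>i\<in>{1..n}. m i *\<^sub>R q i) = (\<Sum>i\<in>{1..n}. 3 *\<^sub>R (m i *\<^sub>R q i))"
    using F_deriv_momentum[of m n q q] assms by (simp add: F_deriv_scaling mult.commute)
  also have "\<dots> = 3 *\<^sub>R (\<Sum>i\<in>{1..n}. m i *\<^sub>R q i)" by (simp only: scaleR_sum_right)
  finally have *: "(\<Sum>i\<in>{1..n}. m i *\<^sub>R q i) = 3 *\<^sub>R (\<Sum>i\<in>{1..n}. m i *\<^sub>R q i)" .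
  have "x = 0" if "x = 3 *\<^sub>R x" for x :: "real^3"
    using that by (simp add: Finite_Cartesian_Product.vec_eq_iff)
  from this[OF *] show ?thesis .
qed

section \<open>Infinitesimal rotations and velocities in an orbit\<close>

definition rotation_about :: "3 \<Rightarrow> real \<Rightarrow> real^3^3" where
  "rotation_about k t =
     (if k = 1 then vector [vector [1, 0, 0], vector [0, cos t, - sin t], vector [0, sin t, cos t]]
      else if k = 2 then vector [vector [cos t, 0, sin t], vector [0, 1, 0], vector [- sin t, 0, cos t]]
      else vector [vector [cos t, - sin t, 0], vector [sin t, cos t, 0], vector [0, 0, 1]])"

lemma rotation_about_eq:
  "rotation_about 1 t *v x = vector [x $ 1, cos t * x $ 2 - sin t * x $ 3, sin t * x $ 2 + cos t * x $ 3]"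
  "rotation_about 2 t *v x = vector [cos t * x $ 1 + sin t * x $ 3, x $ 2, cos t * x $ 3 - sin t * x $ 1]"
  "rotation_about 3 t *v x = vector [cos t * x $ 1 - sin t * x $ 2, sin t * x $ 1 + cos t * x $ 2, x $ 3]"
  by (simp_all add: rotation_about_def Finite_Cartesian_Product.vec_eq_iff forall_3 matrix_vector_mult_def sum_3)

lemma rotation_matrix_rotation_about: "rotation_matrix (rotation_about k t)"
proof -
  consider "k = 1" | "k = 2" | "k = 3" using exhaust_3 by blast
  then have "orthogonal_matrix (rotation_about k t) \<and> Determinants.det (rotation_about k t) = 1"
    by cases (simp_all add: rotation_about_def orthogonal_matrix Finite_Cartesian_Product.vec_eq_iff forall_3
       matrix_matrix_mult_def transpose_def sum_3 Finite_Cartesian_Product.mat_def det_3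
       sin_cos_squared_add3[of t] sin_cos_squared_add3[of t, unfolded add.commute[of "cos t * cos t"]])
  then show ?thesis by (simp add: rotation_matrix_def)
qed

lemma rotation_about_0: "rotation_about k 0 *v x = x"
proof -
  consider "k = 1" | "k = 2" | "k = 3" using exhaust_3 by blast
  then show ?thesis by cases (simp_all add: rotation_about_eq Finite_Cartesian_Product.vec_eq_iff forall_3)
qed

lemma has_vector_derivative_componentwise:
  fixes f :: "real \<Rightarrow> real^'n"
  assumes "\<And>k. ((\<lambda>t. f t $ k) has_real_derivative f' $ k) (at x)"
  shows "(f has_vector_derivative f') (at x)"
  using assms unfolding has_vector_derivative_def has_field_derivative_def
  by (subst has_derivative_componentwise_within) (auto simp: Basis_vec_def inner_axis mult_commute_abs)

lemma rotation_about_velocity: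
  "((\<lambda>t. rotation_about k t *v x) has_vector_derivative axis k 1 \<times> x) (at 0)"
proof -
  consider "k = 1" | "k = 2" | "k = 3" using exhaust_3 by blast
  then have "\<forall>l. ((\<lambda>t. (rotation_about k t *v x) $ l) has_real_derivative (axis k 1 \<times> x) $ l) (at 0)"
    by cases (auto intro!: derivative_eq_intros simp: forall_3 rotation_about_eq cross3_def axis_def)
  then show ?thesis by (intro has_vector_derivative_componentwise) blast
qed

text \<open>Infinitesimal rotations can realise prescribed values of the three coordinates that the
  reduced system holds at zero; \<open>a\<close> and \<open>b\<close> stand for the bodies \<open>n - 1\<close> and \<open>n - 2\<close>.\<close>

lemma rotation_gauge_exists:
  fixes a b v w :: "real^3"
  assumes a: "a $ 2 = 0" "a $ 3 = 0" "a $ 1 \<noteq> 0" and b: "b $ 3 = 0" "b $ 2 \<noteq> 0"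
  obtains \<omega> where "(\<omega> \<times> a) $ 2 = v $ 2" "(\<omega> \<times> a) $ 3 = v $ 3" "(\<omega> \<times> b) $ 3 = w $ 3"
proof
  let ?\<omega> = "vector [(w $ 3 - v $ 3 / a $ 1 * b $ 1) / b $ 2, - v $ 3 / a $ 1, v $ 2 / a $ 1] :: real^3"
  show "(?\<omega> \<times> a) $ 2 = v $ 2" "(?\<omega> \<times> a) $ 3 = v $ 3" "(?\<omega> \<times> b) $ 3 = w $ 3"
    using a b by (simp_all add: cross3_def)
qed

lemma rotation_gauge_unique:
  fixes a b :: "real^3"
  assumes a: "a $ 2 = 0" "a $ 3 = 0" "a $ 1 \<noteq> 0" and b: "b $ 3 = 0" "b $ 2 \<noteq> 0"
    and "(\<omega> \<times> a) $ 2 = 0" "(\<omega> \<times> a) $ 3 = 0" "(\<omega> \<times> b) $ 3 = 0"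
  shows "\<omega> = 0"
  using assms by (simp add: cross3_def Finite_Cartesian_Product.vec_eq_iff forall_3)

text \<open>The hypotheses say that \<open>v\<close> and \<open>w\<close> preserve the inner products of \<open>a\<close> and \<open>b\<close> to first order. After
  subtracting the rotation that matches three of the six coordinates, these three linear equations
  annihilate the other three.\<close>

lemma infinitesimal_rotation_exists:
  fixes a b v w :: "real^3"
  assumes a: "a $ 2 = 0" "a $ 3 = 0" "a $ 1 \<noteq> 0" and b: "b $ 3 = 0" "b $ 2 \<noteq> 0"
    and "v \<bullet> a = 0" "w \<bullet> b = 0" "v \<bullet> b + a \<bullet> w = 0"
  obtains \<omega> where "v = \<omega> \<times> a" "w = \<omega> \<times> b"
proof -
  obtain \<omega> where \<omega>: "(\<omega> \<times> a) $ 2 = v $ 2" "(\<omega> \<times> a) $ 3 = v $ 3" "(\<omega> \<times> b) $ 3 = w $ 3"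
    using rotation_gauge_exists[OF a b] by blast
  define v' where "v' = v - \<omega> \<times> a"
  define w' where "w' = w - \<omega> \<times> b"
  have zero: "v' $ 2 = 0" "v' $ 3 = 0" "w' $ 3 = 0" using \<omega> by (simp_all add: v'_def w'_def)
  have "(\<omega> \<times> a) \<bullet> b + a \<bullet> (\<omega> \<times> b) = 0" by (simp add: cross3_simps)
  then have vb: "v' \<bullet> b + a \<bullet> w' = 0"
    using assms(8) by (simp add: v'_def w'_def inner_diff_left inner_diff_right)
  have "v' \<bullet> a = 0" using assms(6) by (simp add: v'_def inner_diff_left dot_cross_self)
  then have v1: "v' $ 1 = 0" using a zero by (simp add: inner_vec_def sum_3)
  have w1: "w' $ 1 = 0" using vb a zero v1 by (simp add: inner_vec_def sum_3)
  have "w' \<bullet> b = 0" using assms(7) by (simp add: w'_def inner_diff_left dot_cross_self)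
  then have "w' $ 2 = 0" using b w1 by (simp add: inner_vec_def sum_3)
  with zero v1 w1 have "v' = 0" "w' = 0"
    by (simp_all add: Finite_Cartesian_Product.vec_eq_iff forall_3)
  then show ?thesis using that[of \<omega>] by (simp add: v'_def w'_def)
qed

text \<open>Two independent bodies \<open>a\<close> and \<open>b\<close> determine the rotation. Their velocities are \<open>\<omega> \<times> q a\<close> and \<open>\<omega> \<times> q b\<close>
  for a common \<open>\<omega>\<close> because rotations preserve inner products. Every other body is a fixed linear
  combination of \<open>q a\<close>, \<open>q b\<close> and \<open>q a \<times> q b\<close>, a relation that rotations preserve, so its velocity follows
  by the product rule and the Jacobi identity. Only positions are differentiated, because the
  rotations chosen at different times need not depend differentiably on time.\<close>

lemma orbit_velocity_is_rotation:
  fixes \<gamma> :: "real \<Rightarrow> nat \<Rightarrow> real^3"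
  assumes orbit: "\<And>t. \<gamma> t \<in> SO3_orbit n q"
    and "\<And>i. i \<in> {1..n} \<Longrightarrow> \<gamma> 0 i = q i"
    and "\<And>i. i \<in> {1..n} \<Longrightarrow> ((\<lambda>t. \<gamma> t i) has_vector_derivative v i) (at 0)"
    and ab: "a \<in> {1..n}" "b \<in> {1..n}"
    and a: "q a $ 2 = 0" "q a $ 3 = 0" "q a $ 1 \<noteq> 0" and b: "q b $ 3 = 0" "q b $ 2 \<noteq> 0"
  obtains \<omega> where "\<And>i. i \<in> {1..n} \<Longrightarrow> v i = \<omega> \<times> q i"
proof -
  obtain R :: "real \<Rightarrow> real^3^3" where
    R: "\<And>t. rotation_matrix (R t)" and \<gamma>: "\<And>t i. i \<in> {1..n} \<Longrightarrow> \<gamma> t i = R t *v q i"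
    using orbit unfolding SO3_orbit_def mem_Collect_eq by metis
  have inner: "v i \<bullet> q j + q i \<bullet> v j = 0" if "i \<in> {1..n}" "j \<in> {1..n}" for i j
  proof -
    have "(R t *v x) \<bullet> (R t *v y) = x \<bullet> y" for t x y
      using R[of t] orthogonal_transformation_matrix[of "(*v) (R t)"]
      by (simp add: rotation_matrix_def orthogonal_transformation_def)
    then have "\<gamma> t i \<bullet> \<gamma> t j = q i \<bullet> q j" for t using \<gamma> that by simp
    moreover have "((\<lambda>t. \<gamma> t i \<bullet> \<gamma> t j) has_vector_derivative \<gamma> 0 i \<bullet> v j + v i \<bullet> \<gamma> 0 j) (at 0)"
      using bounded_bilinear.has_vector_derivative[OF bounded_bilinear_inner assms(3) assms(3)] that by simp
    ultimately have "((\<lambda>t. q i \<bullet> q j) has_vector_derivative q i \<bullet> v j + v i \<bullet> q j) (at 0)"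
      using assms(2) that by simp
    from vector_derivative_unique_at[OF this has_vector_derivative_const] show ?thesis by simp
  qed
  obtain \<omega> where \<omega>: "v a = \<omega> \<times> q a" "v b = \<omega> \<times> q b"
    using infinitesimal_rotation_exists[OF a b, of "v a" "v b"] inner[of a a] inner[of b b] inner[of a b] ab
    by (auto simp: inner_commute)
  have "v i = \<omega> \<times> q i" if i: "i \<in> {1..n}" for i
  proof -
    \<comment> \<open>The coordinates of \<open>q i\<close> in the basis \<open>q a\<close>, \<open>q b\<close>, \<open>q a \<times> q b = (0, 0, x a * y b)\<close>.\<close>
    let ?\<delta> = "q i $ 3 / (q a $ 1 * q b $ 2)" and ?\<beta> = "q i $ 2 / q b $ 2"
    let ?\<alpha> = "(q i $ 1 - ?\<beta> * q b $ 1) / q a $ 1"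
    have qi: "q i = ?\<alpha> *\<^sub>R q a + ?\<beta> *\<^sub>R q b + ?\<delta> *\<^sub>R (q a \<times> q b)"
      using a b by (simp add: cross3_def Finite_Cartesian_Product.vec_eq_iff forall_3)
    have "\<gamma> t i = ?\<alpha> *\<^sub>R \<gamma> t a + ?\<beta> *\<^sub>R \<gamma> t b + ?\<delta> *\<^sub>R (\<gamma> t a \<times> \<gamma> t b)" for t
    proof -
      have "R t *v q i = R t *v (?\<alpha> *\<^sub>R q a + ?\<beta> *\<^sub>R q b + ?\<delta> *\<^sub>R (q a \<times> q b))"
        using qi by simp
      also have "\<dots> = ?\<alpha> *\<^sub>R (R t *v q a) + ?\<beta> *\<^sub>R (R t *v q b) + ?\<delta> *\<^sub>R (R t *v (q a \<times> q b))"
        by (simp only: matrix_vector_right_distrib matrix_vector_mult_scaleR)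
      finally show ?thesis using \<gamma> i ab cross_rotation_matrix[OF R[of t]] by simp
    qed
    moreover have "((\<lambda>t. ?\<alpha> *\<^sub>R \<gamma> t a + ?\<beta> *\<^sub>R \<gamma> t b + ?\<delta> *\<^sub>R (\<gamma> t a \<times> \<gamma> t b)) has_vector_derivative
       ?\<alpha> *\<^sub>R v a + ?\<beta> *\<^sub>R v b + ?\<delta> *\<^sub>R (q a \<times> v b + v a \<times> q b)) (at 0)"
    proof -
      have c: "bounded_bilinear (\<times>)" using bilinear_cross bilinear_conv_bounded_bilinear by blast
      have "((\<lambda>t. \<gamma> t a \<times> \<gamma> t b) has_vector_derivative \<gamma> 0 a \<times> v b + v a \<times> \<gamma> 0 b) (at 0)"
        using bounded_bilinear.has_vector_derivative[OF c assms(3) assms(3)] ab by simp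
      then have "((\<lambda>t. \<gamma> t a \<times> \<gamma> t b) has_vector_derivative q a \<times> v b + v a \<times> q b) (at 0)"
        using assms(2) ab by simp
      note * = this assms(3)[OF ab(1)] assms(3)[OF ab(2)]
      have sc: "((\<lambda>t. c *\<^sub>R f t) has_vector_derivative c *\<^sub>R f') (at 0)"
        if "(f has_vector_derivative f') (at 0)" for c :: real and f :: "real \<Rightarrow> real^3" and f'
        using bounded_linear.has_vector_derivative[OF bounded_linear_scaleR_right that] .
      show ?thesis by (intro has_vector_derivative_add sc *)
    qed
    ultimately have "((\<lambda>t. \<gamma> t i) has_vector_derivative
       ?\<alpha> *\<^sub>R v a + ?\<beta> *\<^sub>R v b + ?\<delta> *\<^sub>R (q a \<times> v b + v a \<times> q b)) (at 0)" by simp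
    from vector_derivative_unique_at[OF assms(3)[OF i] this]
    have "v i = ?\<alpha> *\<^sub>R v a + ?\<beta> *\<^sub>R v b + ?\<delta> *\<^sub>R (q a \<times> v b + v a \<times> q b)" .
    also have "q a \<times> v b + v a \<times> q b = \<omega> \<times> (q a \<times> q b)"
      unfolding \<omega> by (simp add: cross3_simps forall_3)
    also have "?\<alpha> *\<^sub>R v a + ?\<beta> *\<^sub>R v b + ?\<delta> *\<^sub>R (\<omega> \<times> (q a \<times> q b))
        = \<omega> \<times> (?\<alpha> *\<^sub>R q a + ?\<beta> *\<^sub>R q b + ?\<delta> *\<^sub>R (q a \<times> q b))"
      unfolding \<omega> by (simp only: cross_add_right cross_mult_right)
    finally show ?thesis using qi by simp
  qed
  with that show ?thesis by blast
qed

section \<open>Jacobian matrices acting on displacements\<close>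

definition pack :: "(nat \<times> 3) list \<Rightarrow> (nat \<Rightarrow> real^3) \<Rightarrow> real Matrix.vec" where
  "pack ls w = Matrix.vec (length ls) (\<lambda>r. w (fst (ls ! r)) $ snd (ls ! r))"

definition unit_displacement :: "nat \<times> 3 \<Rightarrow> nat \<Rightarrow> real^3" where
  "unit_displacement v j = (if j = fst v then axis (snd v) 1 else 0)"

text \<open>The right inverse of \<open>pack\<close> whose values have all unlisted coordinates equal to \<open>0\<close>.\<close>

definition unpack :: "(nat \<times> 3) list \<Rightarrow> real Matrix.vec \<Rightarrow> nat \<Rightarrow> real^3" where
  "unpack ls x j = (\<Sum>c<length ls. vec_index x c *\<^sub>R unit_displacement (ls ! c) j)"

lemma pack_carrier: "pack ls w \<in> carrier_vec (length ls)"
  by (simp add: pack_def)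

lemma pack_eq_iff: "pack ls w = pack ls w' \<longleftrightarrow> (\<forall>(i, k)\<in>set ls. w i $ k = w' i $ k)"
  by (simp add: pack_def Matrix.vec_eq_iff all_set_conv_all_nth split_beta)

lemma pack_eq_0_iff: "pack ls w = 0\<^sub>v (length ls) \<longleftrightarrow> (\<forall>(i, k)\<in>set ls. w i $ k = 0)"
  by (simp add: pack_def Matrix.vec_eq_iff all_set_conv_all_nth split_beta)

lemma pack_add: "pack ls (\<lambda>i. u i + w i) = pack ls u + pack ls w"
  by (auto simp: pack_def)

lemma pack_scaleR: "pack ls (\<lambda>i. c *\<^sub>R w i) = c \<cdot>\<^sub>v pack ls w"
  by (auto simp: pack_def)

lemma unit_displacement_component: "unit_displacement v j $ k = (if v = (j, k) then 1 else 0)"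
  by (cases v) (auto simp: unit_displacement_def axis_def)

lemma unpack_component:
  assumes "distinct ls" "r < length ls"
  shows "unpack ls x (fst (ls ! r)) $ snd (ls ! r) = vec_index x r"
proof -
  have "unpack ls x (fst (ls ! r)) $ snd (ls ! r) = (\<Sum>c<length ls. if c = r then vec_index x c else 0)"
    unfolding unpack_def sum_component
    using assms by (intro sum.cong) (auto simp: unit_displacement_component nth_eq_iff_index_eq)
  then show ?thesis using assms by simp
qed

lemma unpack_component_outside: "(j, k) \<notin> set ls \<Longrightarrow> unpack ls x j $ k = 0"
  unfolding unpack_def sum_component in_set_conv_nth
  by (intro sum.neutral) (auto simp: unit_displacement_component)

lemma pack_unpack:
  assumes "distinct ls" "x \<in> carrier_vec (length ls)"
  shows "pack ls (unpack ls x) = x"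
  using assms by (auto simp: pack_def Matrix.vec_eq_iff unpack_component)

lemma unpack_pack:
  assumes "distinct ls"
  shows "unpack ls (pack ls w) j $ k = (if (j, k) \<in> set ls then w j $ k else 0)"
proof (cases "(j, k) \<in> set ls")
  case True
  then obtain r where "r < length ls" "ls ! r = (j, k)" by (auto simp: in_set_conv_nth)
  then show ?thesis using unpack_component[OF assms, of r "pack ls w"] True by (simp add: pack_def)
qed (simp add: unpack_component_outside)

lemma jacobian_mat_carrier: "jacobian_mat G eqs vars q \<in> carrier_mat (length eqs) (length vars)"
  by (simp add: jacobian_mat_def)

text \<open>The bridge from matrices of partial derivatives to directional derivatives: a Jacobian matrix acts on
  packed displacements as any \<open>L\<close> that gives the directional derivatives along the coordinate
  directions and is linear.\<close>

lemma jacobian_mat_mult_vec: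
  assumes x: "x \<in> carrier_vec (length vars)"
    and deriv: "\<And>i v. i \<in> fst ` set eqs \<Longrightarrow> v \<in> set vars \<Longrightarrow>
      ((\<lambda>t. G (\<lambda>j. q j + t *\<^sub>R unit_displacement v j) i) has_vector_derivative L (unit_displacement v) i) (at 0)"
    and lin: "\<And>i. i \<in> fst ` set eqs \<Longrightarrow>
      L (unpack vars x) i = (\<Sum>c<length vars. vec_index x c *\<^sub>R L (unit_displacement (vars ! c)) i)"
  shows "jacobian_mat G eqs vars q *\<^sub>v x = pack eqs (L (unpack vars x))"
proof (rule eq_vecI)
  have partial: "partial (\<lambda>p. G p i $ k) v q = L (unit_displacement v) i $ k"
    if "i \<in> fst ` set eqs" "v \<in> set vars" for i k v
  proof -
    have "q(fst v := q (fst v) + t *\<^sub>R axis (snd v) 1) = (\<lambda>j. q j + t *\<^sub>R unit_displacement v j)" for t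
      by (auto simp: unit_displacement_def)
    moreover have "((\<lambda>t. G (\<lambda>j. q j + t *\<^sub>R unit_displacement v j) i $ k)
        has_real_derivative L (unit_displacement v) i $ k) (at 0)"
      unfolding has_real_derivative_iff_has_vector_derivative
      by (rule bounded_linear.has_vector_derivative[OF bounded_linear_vec_nth deriv[OF that]])
    ultimately show ?thesis
      by (simp add: partial_def split_beta DERIV_imp_deriv)
  qed
  show "dim_vec (jacobian_mat G eqs vars q *\<^sub>v x) = dim_vec (pack eqs (L (unpack vars x)))"
    by (simp add: jacobian_mat_def pack_def)
  fix r assume "r < dim_vec (pack eqs (L (unpack vars x)))"
  then have r: "r < length eqs" by (simp add: pack_def)
  then have i: "fst (eqs ! r) \<in> fst ` set eqs" by simp
  have "vec_index (jacobian_mat G eqs vars q *\<^sub>v x) r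
      = (\<Sum>c<length vars. partial (\<lambda>p. G p (fst (eqs ! r)) $ snd (eqs ! r)) (vars ! c) q * vec_index x c)"
    using x r by (simp add: jacobian_mat_def scalar_prod_def lessThan_atLeast0)
  also have "\<dots> = (\<Sum>c<length vars. vec_index x c * L (unit_displacement (vars ! c)) (fst (eqs ! r)) $ snd (eqs ! r))"
    using i by (intro sum.cong) (simp_all add: partial)
  also have "\<dots> = L (unpack vars x) (fst (eqs ! r)) $ snd (eqs ! r)"
    unfolding lin[OF i] by (simp add: sum_component)
  also have "\<dots> = vec_index (pack eqs (L (unpack vars x))) r"
    using r by (simp add: pack_def)
  finally show "vec_index (jacobian_mat G eqs vars q *\<^sub>v x) r = vec_index (pack eqs (L (unpack vars x))) r" .
qed

lemma set_coords: "set (coords n) = {(i, k). i \<in> {1..n}}"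
  using exhaust_3 by (force simp: coords_def)

lemma length_coords: "length (coords n) = 3 * n"
  by (induction n) (simp_all add: coords_def)

lemma distinct_coords: "distinct (coords n)"
proof (induction n)
  case (Suc n)
  have "coords (Suc n) = coords n @ [(Suc n, 1), (Suc n, 2), (Suc n, 3)]"
    by (simp add: coords_def)
  then show ?case using Suc by (auto simp: set_coords)
qed (simp add: coords_def)

section \<open>Nondegenerate central configurations\<close>

lemma DF_mult_vec:
  assumes "inj_on q {1..n}" "x \<in> carrier_vec (3 * n)"
  shows "DF n m q *\<^sub>v x = pack (coords n) (F_deriv n m q (unpack (coords n) x))"
  unfolding DF_def
proof (rule jacobian_mat_mult_vec)
  show "F_deriv n m q (unpack (coords n) x) i
      = (\<Sum>c<length (coords n). vec_index x c *\<^sub>R F_deriv n m q (unit_displacement (coords n ! c)) i)" for i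
    using F_deriv_sum[of "{..<length (coords n)}" n m q "vec_index x" "\<lambda>c. unit_displacement (coords n ! c)" i]
    by (simp add: unpack_def[abs_def])
qed (use assms in \<open>auto simp: length_coords set_coords intro!: F_has_directional_derivative\<close>)

lemma DF_kernel_iff:
  assumes "inj_on q {1..n}" "x \<in> carrier_vec (3 * n)"
  shows "DF n m q *\<^sub>v x = 0\<^sub>v (3 * n) \<longleftrightarrow> (\<forall>i\<in>{1..n}. F_deriv n m q (unpack (coords n) x) i = 0)"
  using pack_eq_0_iff[of "coords n"] DF_mult_vec[OF assms]
  by (auto simp: set_coords length_coords Finite_Cartesian_Product.vec_eq_iff)

text \<open>Velocities of curves in the orbit are infinitesimal rotations, and these form a subspace that is
  spanned by the velocities of the rotations about the three coordinate axes.\<close>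

lemma span_orbit_velocities:
  assumes ab: "a \<in> {1..n}" "b \<in> {1..n}"
    and a: "q a $ 2 = 0" "q a $ 3 = 0" "q a $ 1 \<noteq> 0" and b: "q b $ 3 = 0" "q b $ 2 \<noteq> 0"
  shows "LinearCombinations.module.span class_ring (module_vec TYPE(real) (3 * n)) (orbit_velocities n q)
       = range (\<lambda>\<omega>. pack (coords n) (\<lambda>i. \<omega> \<times> q i))"
proof -
  interpret V: vec_space "TYPE(real)" "3 * n" .
  let ?rot = "\<lambda>\<omega>. pack (coords n) (\<lambda>i. \<omega> \<times> q i)"
  have rot_add: "?rot (\<omega> + \<omega>') = ?rot \<omega> + ?rot \<omega>'" for \<omega> \<omega>'
    by (simp add: cross_add_left pack_add)
  have rot_scale: "?rot (c *\<^sub>R \<omega>) = c \<cdot>\<^sub>v ?rot \<omega>" for c \<omega>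
    by (simp add: cross_mult_left pack_scaleR)
  have rot_carrier: "?rot \<omega> \<in> carrier_vec (3 * n)" for \<omega>
    using pack_carrier[of "coords n"] by (simp add: length_coords)
  have "?rot 0 = 0\<^sub>v (3 * n)" using pack_eq_0_iff[of "coords n"] by (simp add: length_coords)
  then have "0\<^sub>v (3 * n) \<in> range ?rot" by (metis rangeI)
  then have sub: "submodule class_ring (range ?rot) V.V"
    by unfold_locales (auto simp: rot_carrier simp flip: rot_add rot_scale)
  have vel: "orbit_velocities n q \<subseteq> range ?rot"
  proof
    fix x assume "x \<in> orbit_velocities n q"
    then obtain v \<gamma> where x: "x = pack (coords n) v" and \<gamma>: "\<And>t::real. \<gamma> t \<in> SO3_orbit n q"
      "\<And>i. i \<in> {1..n} \<Longrightarrow> \<gamma> 0 i = q i"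
      "\<And>i. i \<in> {1..n} \<Longrightarrow> ((\<lambda>t. \<gamma> t i) has_vector_derivative v i) (at 0)"
      unfolding orbit_velocities_def pack_def length_coords by blast
    obtain \<omega> where "\<And>i. i \<in> {1..n} \<Longrightarrow> v i = \<omega> \<times> q i"
      using orbit_velocity_is_rotation[OF \<gamma> ab a b] by blast
    then have "x = ?rot \<omega>" unfolding x pack_eq_iff by (auto simp: set_coords)
    then show "x \<in> range ?rot" by blast
  qed
  have axis: "?rot (axis k 1) \<in> orbit_velocities n q" for k
  proof -
    have "(\<lambda>i. rotation_about k t *v q i) \<in> SO3_orbit n q" for t
      using rotation_matrix_rotation_about by (auto simp: SO3_orbit_def)
    then show ?thesis
      unfolding orbit_velocities_def pack_def length_coords
      using rotation_about_0 rotation_about_velocity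
      by (intro CollectI exI[of _ "\<lambda>i. axis k 1 \<times> q i"] conjI refl exI[of _ "\<lambda>t i. rotation_about k t *v q i"]) auto
  qed
  have carrier: "orbit_velocities n q \<subseteq> carrier_vec (3 * n)" using vel rot_carrier by auto
  have "range ?rot \<subseteq> V.span (orbit_velocities n q)"
  proof clarify
    fix \<omega> :: "real^3"
    have "\<omega> = \<omega> $ 1 *\<^sub>R axis 1 1 + (\<omega> $ 2 *\<^sub>R axis 2 1 + \<omega> $ 3 *\<^sub>R axis 3 1)"
      by (simp add: Finite_Cartesian_Product.vec_eq_iff forall_3 axis_def)
    then have "?rot \<omega> = \<omega> $ 1 \<cdot>\<^sub>v ?rot (axis 1 1) + (\<omega> $ 2 \<cdot>\<^sub>v ?rot (axis 2 1) + \<omega> $ 3 \<cdot>\<^sub>v ?rot (axis 3 1))"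
      by (metis rot_add rot_scale)
    moreover have "c \<cdot>\<^sub>v ?rot (axis k 1) \<in> V.span (orbit_velocities n q)" for c k
      using V.smult_in_span[OF carrier] V.span_mem[of "orbit_velocities n q"] carrier axis by simp
    ultimately show "?rot \<omega> \<in> V.span (orbit_velocities n q)"
      using V.span_add1[of "orbit_velocities n q"] carrier by simp
  qed
  moreover have "V.span (orbit_velocities n q) \<subseteq> range ?rot"
    using V.span_is_subset[OF vel] sub by simp
  ultimately show ?thesis by blast
qed

text \<open>Nondegeneracy means that the infinitesimal rotations, which always lie in the kernel, are the whole
  kernel.\<close>

lemma nondegenerate_nCC_iff:
  assumes nCC: "nCC n m q" and ab: "a \<in> {1..n}" "b \<in> {1..n}"
    and a: "q a $ 2 = 0" "q a $ 3 = 0" "q a $ 1 \<noteq> 0" and b: "q b $ 3 = 0" "q b $ 2 \<noteq> 0"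
  shows "nondegenerate_nCC n m q \<longleftrightarrow>
    (\<forall>w. (\<forall>i\<in>{1..n}. F_deriv n m q w i = 0) \<longrightarrow> (\<exists>\<omega>. \<forall>i\<in>{1..n}. w i = \<omega> \<times> q i))"
proof -
  interpret V: vec_space "TYPE(real)" "3 * n" .
  let ?rot = "\<lambda>\<omega>. pack (coords n) (\<lambda>i. \<omega> \<times> q i)"
  let ?S = "orbit_velocities n q"
  have inj: "inj_on q {1..n}" and F0: "\<And>i. i \<in> {1..n} \<Longrightarrow> F n m q i = 0"
    using nCC by (auto simp: nCC_def configuration_def)
  note carrier = pack_carrier[of "coords n", unfolded length_coords]
  have A: "DF n m q \<in> carrier_mat (3 * n) (3 * n)"
    unfolding DF_def using jacobian_mat_carrier[of "F n m" "coords n" "coords n"] by (simp add: length_coords)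
  have kernel_pack: "DF n m q *\<^sub>v pack (coords n) w = 0\<^sub>v (3 * n) \<longleftrightarrow> (\<forall>i\<in>{1..n}. F_deriv n m q w i = 0)" for w
  proof -
    have "unpack (coords n) (pack (coords n) w) j = w j" if "j \<in> {1..n}" for j
      using that by (simp add: Finite_Cartesian_Product.vec_eq_iff unpack_pack distinct_coords set_coords)
    then show ?thesis unfolding DF_kernel_iff[OF inj carrier] using F_deriv_cong by (metis (no_types, lifting))
  qed
  have span: "V.span ?S = range ?rot" by (rule span_orbit_velocities[OF ab a b])
  have S: "?S \<subseteq> carrier_vec (3 * n)"
    unfolding orbit_velocities_def by auto
  have "?S \<subseteq> V.span ?S" using V.in_own_span S by simp
  then have "DF n m q *\<^sub>v s = 0\<^sub>v (3 * n)" if "s \<in> ?S" for s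
    using that unfolding span by (auto simp: kernel_pack F_deriv_rotation F0)
  then have "nondegenerate_nCC n m q \<longleftrightarrow>
      (\<forall>x\<in>carrier_vec (3 * n). DF n m q *\<^sub>v x = 0\<^sub>v (3 * n) \<longrightarrow> x \<in> range ?rot)"
    using V.rank_eq_iff_kernel_le_span[OF A S] nCC
    by (simp add: nondegenerate_nCC_def SO3_orbit_dim_def span)
  also have "\<dots> \<longleftrightarrow> (\<forall>w. DF n m q *\<^sub>v pack (coords n) w = 0\<^sub>v (3 * n) \<longrightarrow> pack (coords n) w \<in> range ?rot)"
    using carrier pack_unpack[OF distinct_coords, of _ n, unfolded length_coords] by metis
  also have "\<dots> \<longleftrightarrow> (\<forall>w. (\<forall>i\<in>{1..n}. F_deriv n m q w i = 0) \<longrightarrow> (\<exists>\<omega>. \<forall>i\<in>{1..n}. w i = \<omega> \<times> q i))"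
  proof -
    have "pack (coords n) w = ?rot \<omega> \<longleftrightarrow> (\<forall>i\<in>{1..n}. w i = \<omega> \<times> q i)" for w \<omega>
      by (auto simp: pack_eq_iff set_coords Finite_Cartesian_Product.vec_eq_iff)
    then show ?thesis unfolding kernel_pack image_iff by simp
  qed
  finally show ?thesis .
qed

section \<open>The reduced system\<close>

lemma com_position_sum:
  assumes "finite C"
  shows "com_position n m (\<lambda>j. \<Sum>c\<in>C. x c *\<^sub>R u c j) = (\<Sum>c\<in>C. x c *\<^sub>R com_position n m (u c))"
proof -
  have "(\<Sum>i\<in>{1..n - 1}. m i *\<^sub>R (\<Sum>c\<in>C. x c *\<^sub>R u c i)) = (\<Sum>c\<in>C. x c *\<^sub>R (\<Sum>i\<in>{1..n - 1}. m i *\<^sub>R u c i))"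
    unfolding scaleR_sum_right by (subst sum.swap) (simp add: mult.commute)
  then show ?thesis by (simp add: com_position_def scaleR_sum_right mult.commute)
qed

lemma com_position_cong:
  assumes "\<And>i. i \<in> {1..n - 1} \<Longrightarrow> u i = w i"
  shows "com_position n m u = com_position n m w"
  using assms by (simp add: com_position_def)

lemma com_position_eq_iff:
  assumes "n \<ge> 1" "m n \<noteq> 0"
  shows "w n = com_position n m w \<longleftrightarrow> (\<Sum>i\<in>{1..n}. m i *\<^sub>R w i) = 0"
proof -
  have "{1..n} = insert n {1..n - 1}" using assms by auto
  then have "(\<Sum>i\<in>{1..n}. m i *\<^sub>R w i) = m n *\<^sub>R w n + (\<Sum>i\<in>{1..n - 1}. m i *\<^sub>R w i)"
    using assms by simp
  moreover have "w n = com_position n m w \<longleftrightarrow> m n *\<^sub>R w n = m n *\<^sub>R com_position n m w"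
    using assms by simp
  moreover have "m n *\<^sub>R com_position n m w = - (\<Sum>i\<in>{1..n - 1}. m i *\<^sub>R w i)"
    using assms by (simp add: com_position_def)
  ultimately show ?thesis by (simp add: eq_neg_iff_add_eq_0)
qed

text \<open>The displacement of the last body is forced by the center of mass condition.\<close>

definition complete_com :: "nat \<Rightarrow> (nat \<Rightarrow> real) \<Rightarrow> (nat \<Rightarrow> real^3) \<Rightarrow> nat \<Rightarrow> real^3" where
  "complete_com n m w = w(n := com_position n m w)"

lemma complete_com_sum:
  assumes "finite C"
  shows "complete_com n m (\<lambda>j. \<Sum>c\<in>C. x c *\<^sub>R u c j) = (\<lambda>j. \<Sum>c\<in>C. x c *\<^sub>R complete_com n m (u c) j)"
  using com_position_sum[OF assms, of n m x u] by (auto simp: complete_com_def)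

text \<open>The completion by the center of mass is linear, so this is the chain rule.\<close>

lemma Fred_has_directional_derivative:
  assumes "inj_on q {1..n}" "i \<in> {1..n}" and q: "q n = com_position n m q"
  shows "((\<lambda>t. Fred n m (\<lambda>j. q j + t *\<^sub>R w j) i) has_vector_derivative
          F_deriv n m q (complete_com n m w) i) (at 0)"
proof -
  have "com_position n m (\<lambda>j. q j + t *\<^sub>R w j) = com_position n m q + t *\<^sub>R com_position n m w" for t
    \<comment> \<open>A sum of two terms, indexed by the two truth values.\<close>
    using com_position_sum[of "UNIV :: bool set" n m "\<lambda>c. if c then t else 1" "\<lambda>c. if c then w else q"]
    by (simp add: UNIV_bool add.commute)
  then have "(\<lambda>j. q j + t *\<^sub>R w j)(n := com_position n m (\<lambda>j. q j + t *\<^sub>R w j))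
      = (\<lambda>j. q j + t *\<^sub>R complete_com n m w j)" for t
    using q by (auto simp: complete_com_def)
  then show ?thesis
    unfolding Fred_def using F_has_directional_derivative[OF assms(1,2), of m "complete_com n m w"] by simp
qed

lemma set_RS_coords:
  "set (RS_coords n) = {(i, k). i \<in> {1..n - 3}} \<union> {(n - 2, 1), (n - 2, 2), (n - 1, 1)}"
  by (simp add: RS_coords_def set_coords)

lemma distinct_RS_coords: "n \<ge> 3 \<Longrightarrow> distinct (RS_coords n)"
  by (auto simp: RS_coords_def set_coords distinct_coords)

lemma RS_jacobian_mult_vec:
  assumes n: "n \<ge> 3" and "inj_on q {1..n}" "q n = com_position n m q"
    and x: "x \<in> carrier_vec (length (RS_coords n))"
  shows "RS_jacobian n m q *\<^sub>v x
       = pack (RS_coords n) (F_deriv n m q (complete_com n m (unpack (RS_coords n) x)))"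
  unfolding RS_jacobian_def
proof (rule jacobian_mat_mult_vec[where L = "\<lambda>w. F_deriv n m q (complete_com n m w)", OF x])
  let ?vars = "RS_coords n"
  show "F_deriv n m q (complete_com n m (unpack ?vars x)) i
      = (\<Sum>c<length ?vars. vec_index x c *\<^sub>R F_deriv n m q (complete_com n m (unit_displacement (?vars ! c))) i)" for i
    using complete_com_sum[of "{..<length ?vars}" n m "vec_index x" "\<lambda>c. unit_displacement (?vars ! c)"]
      F_deriv_sum[of "{..<length ?vars}" n m q "vec_index x" "\<lambda>c. complete_com n m (unit_displacement (?vars ! c))" i]
    by (simp add: unpack_def[abs_def])
  fix i v assume "i \<in> fst ` set ?vars"
  then have "i \<in> {1..n}" using n by (auto simp: set_RS_coords)
  then show "((\<lambda>t. Fred n m (\<lambda>j. q j + t *\<^sub>R unit_displacement v j) i) has_vector_derivative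
      F_deriv n m q (complete_com n m (unit_displacement v)) i) (at 0)"
    using Fred_has_directional_derivative assms by blast
qed

text \<open>Vectors of reduced unknowns correspond to the displacements that keep \<open>z (n - 2)\<close>, \<open>y (n - 1)\<close>,
  \<open>z (n - 1)\<close> fixed and whose last body is determined by the center of mass condition.\<close>

lemma RS_jacobian_invertible_iff:
  assumes n: "n \<ge> 3" and inj: "inj_on q {1..n}" and q: "q n = com_position n m q" and m: "m n \<noteq> 0"
  shows "invertible_mat (RS_jacobian n m q) \<longleftrightarrow>
    (\<forall>w. w (n - 2) $ 3 = 0 \<and> w (n - 1) $ 2 = 0 \<and> w (n - 1) $ 3 = 0
       \<and> (\<Sum>i\<in>{1..n}. m i *\<^sub>R w i) = 0
       \<and> (\<forall>(i, k)\<in>set (RS_coords n). F_deriv n m q w i $ k = 0)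
       \<longrightarrow> (\<forall>i\<in>{1..n}. w i = 0))"
    (is "_ \<longleftrightarrow> (\<forall>w. ?gauge w \<longrightarrow> _)")
proof -
  let ?ls = "RS_coords n" and ?J = "RS_jacobian n m q"
  note dist = distinct_RS_coords[OF n]
  have J: "?J \<in> carrier_mat (length ?ls) (length ?ls)"
    unfolding RS_jacobian_def by (rule jacobian_mat_carrier)
  have kernel: "?J *\<^sub>v x = 0\<^sub>v (length ?ls) \<longleftrightarrow>
      (\<forall>(i, k)\<in>set ?ls. F_deriv n m q (complete_com n m (unpack ?ls x)) i $ k = 0)"
    if "x \<in> carrier_vec (length ?ls)" for x
    unfolding RS_jacobian_mult_vec[OF n inj q that] by (rule pack_eq_0_iff)
  have label: "i \<in> {1..n - 1}" if "(i, k) \<in> set ?ls" for i k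
    using that n by (auto simp: set_RS_coords)
  have free: "(i, k) \<in> set ?ls \<longleftrightarrow> (i, k) \<notin> {(n - 2, 3), (n - 1, 2), (n - 1, 3)}"
    if "i \<in> {1..n - 1}" for i k
  proof -
    have "i \<in> {1..n - 3} \<or> i = n - 2 \<or> i = n - 1" using that by auto
    then show ?thesis using n exhaust_3[of k] by (auto simp: set_RS_coords)
  qed
  show ?thesis unfolding invertible_mat_iff_kernel_trivial[OF J]
  proof (intro iffI allI impI ballI)
    fix w i
    assume triv: "\<forall>x\<in>carrier_vec (length ?ls). ?J *\<^sub>v x = 0\<^sub>v (length ?ls) \<longrightarrow> x = 0\<^sub>v (length ?ls)"
      and w: "?gauge w" and i: "i \<in> {1..n}"
    let ?x = "pack ?ls w"
    have eq: "unpack ?ls ?x j = w j" if "j \<in> {1..n - 1}" for j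
      using free[OF that] w
      by (auto simp: Finite_Cartesian_Product.vec_eq_iff unpack_pack[OF dist])
    have wn: "w n = com_position n m w" using com_position_eq_iff[of n m w] w m n by simp
    have "complete_com n m (unpack ?ls ?x) j = w j" if "j \<in> {1..n}" for j
    proof (cases "j = n")
      case True
      then show ?thesis using com_position_cong[where m = m, OF eq] wn by (simp add: complete_com_def)
    next
      case False
      then have "j \<in> {1..n - 1}" using that by auto
      then show ?thesis using False eq by (simp add: complete_com_def)
    qed
    then have "F_deriv n m q (complete_com n m (unpack ?ls ?x)) l = F_deriv n m q w l" if "l \<in> {1..n}" for l
      using that by (intro F_deriv_cong) auto
    moreover have "l \<in> {1..n}" if "(l, k) \<in> set ?ls" for l k using label[OF that] by auto
    ultimately have "?J *\<^sub>v ?x = 0\<^sub>v (length ?ls)"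
      using w unfolding kernel[OF pack_carrier] by fastforce
    then have "?x = 0\<^sub>v (length ?ls)" using triv pack_carrier by blast
    then have zero: "\<forall>(l, k)\<in>set ?ls. w l $ k = 0" by (simp add: pack_eq_0_iff)
    have below: "w j = 0" if "j \<in> {1..n - 1}" for j
      using free[OF that] zero w
      by (fastforce simp: Finite_Cartesian_Product.vec_eq_iff)
    show "w i = 0"
    proof (cases "i = n")
      case True
      then show ?thesis using wn below by (simp add: com_position_def)
    next
      case False
      then show ?thesis using i by (intro below) auto
    qed
  next
    fix x
    assume triv: "\<forall>w. ?gauge w \<longrightarrow> (\<forall>i\<in>{1..n}. w i = 0)"
      and x: "x \<in> carrier_vec (length ?ls)" and Jx: "?J *\<^sub>v x = 0\<^sub>v (length ?ls)"
    let ?u = "unpack ?ls x"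
    let ?w = "complete_com n m ?u"
    have same: "?w j = ?u j" if "j \<in> {1..n - 1}" for j using that by (auto simp: complete_com_def)
    have n1: "n - 2 \<in> {1..n - 1}" and n2: "n - 1 \<in> {1..n - 1}" using n by auto
    have "(n - 2, 3) \<notin> set ?ls" "(n - 1, 2) \<notin> set ?ls" "(n - 1, 3) \<notin> set ?ls"
      using n by (auto simp: set_RS_coords)
    then have "?w (n - 2) $ 3 = 0" "?w (n - 1) $ 2 = 0" "?w (n - 1) $ 3 = 0"
      using same[OF n1] same[OF n2] by (simp_all add: unpack_component_outside)
    moreover have "com_position n m ?w = com_position n m ?u"
      using same by (rule com_position_cong)
    then have "?w n = com_position n m ?w" by (simp add: complete_com_def)
    then have "(\<Sum>i\<in>{1..n}. m i *\<^sub>R ?w i) = 0" using com_position_eq_iff[of n m ?w] n m by simp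
    ultimately have "\<forall>i\<in>{1..n}. ?w i = 0"
      using triv kernel[OF x] Jx by blast
    then have "?u j = 0" if "j \<in> {1..n - 1}" for j
      using same[OF that] that by auto
    then have "pack ?ls ?u = 0\<^sub>v (length ?ls)"
      unfolding pack_eq_0_iff using label by fastforce
    then show "x = 0\<^sub>v (length ?ls)" using pack_unpack[OF dist x] by simp
  qed
qed

section \<open>Equivalence of the two notions\<close>

text \<open>Only the bodies \<open>n - 2\<close>, \<open>n - 1\<close>, \<open>n\<close> can carry a force, and of the first two only the components
  dropped from the reduced system. Eliminating \<open>g n\<close> by the force balance, the torque balance becomes
  three linear equations in three unknowns: its third component gives \<open>g (n - 1) $ 2 = 0\<close>
  because \<open>x (n - 1) \<noteq> x n\<close>, and the first two form a system with the nonzero determinant of the hypothesis.\<close>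

lemma balanced_forces_vanish:
  fixes g q :: "nat \<Rightarrow> real^3"
  assumes n: "n \<ge> 3"
    and sum: "(\<Sum>i\<in>{1..n}. g i) = 0" and torque: "(\<Sum>i\<in>{1..n}. q i \<times> g i) = 0"
    and g: "\<forall>(i, k)\<in>set (RS_coords n). g i $ k = 0"
    and x: "q (n - 1) $ 1 - q n $ 1 \<noteq> 0"
    and det: "(q (n - 2) $ 2 - q n $ 2) * (q (n - 1) $ 1 - q n $ 1)
       \<noteq> (q (n - 1) $ 2 - q n $ 2) * (q (n - 2) $ 1 - q n $ 1)"
    and i: "i \<in> {1..n}"
  shows "g i = 0"
proof -
  have g0: "g i = 0" if "i \<in> {1..n} - {n - 2, n - 1, n}" for i
  proof -
    have "i \<in> {1..n - 3}" using that by auto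
    then show ?thesis using g by (auto simp: set_RS_coords Finite_Cartesian_Product.vec_eq_iff)
  qed
  have three: "(\<Sum>i\<in>{1..n}. f i) = f (n - 2) + f (n - 1) + f n"
    if "\<And>i. i \<in> {1..n} - {n - 2, n - 1, n} \<Longrightarrow> f i = 0" for f :: "nat \<Rightarrow> real^3"
  proof -
    have "(\<Sum>i\<in>{1..n}. f i) = (\<Sum>i\<in>{n - 2, n - 1, n}. f i)"
      using n that by (intro sum.mono_neutral_right) auto
    moreover have "n - 2 \<noteq> n - 1" "n - 2 \<noteq> n" "n - 1 \<noteq> n" using n by auto
    ultimately show ?thesis by (simp add: add.assoc)
  qed
  let ?u = "q (n - 2) - q n" and ?v = "q (n - 1) - q n"
  have s: "g (n - 2) + g (n - 1) + g n = 0" using three[of g] g0 sum by simp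
  have t: "q (n - 2) \<times> g (n - 2) + q (n - 1) \<times> g (n - 1) + q n \<times> g n = 0"
    using three[of "\<lambda>i. q i \<times> g i"] g0 torque by simp
  have gn: "g n = - g (n - 2) - g (n - 1)" using s by (simp add: algebra_simps eq_neg_iff_add_eq_0)
  have uv: "?u \<times> g (n - 2) + ?v \<times> g (n - 1) = 0"
    using t unfolding gn by (simp add: Cross3.left_diff_distrib Cross3.right_diff_distrib algebra_simps)
  have c: "g (n - 2) $ 1 = 0" "g (n - 2) $ 2 = 0" "g (n - 1) $ 1 = 0"
    using g by (auto simp: set_RS_coords)
  have "?v $ 1 * g (n - 1) $ 2 = 0"
    using arg_cong[OF uv, of "\<lambda>v. v $ 3"] c by (simp add: cross3_def)
  then have g12: "g (n - 1) $ 2 = 0" using x by simp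
  have e1: "?u $ 2 * g (n - 2) $ 3 + ?v $ 2 * g (n - 1) $ 3 = 0"
    using arg_cong[OF uv, of "\<lambda>v. v $ 1"] c g12 by (simp add: cross3_def)
  have e2: "?u $ 1 * g (n - 2) $ 3 + ?v $ 1 * g (n - 1) $ 3 = 0"
    using arg_cong[OF uv, of "\<lambda>v. v $ 2"] c by (simp add: cross3_def algebra_simps)
  \<comment> \<open>Cramer's rule: eliminate the component of body \<open>n - 1\<close>.\<close>
  have "(?u $ 2 * ?v $ 1 - ?v $ 2 * ?u $ 1) * g (n - 2) $ 3
      = ?v $ 1 * (?u $ 2 * g (n - 2) $ 3 + ?v $ 2 * g (n - 1) $ 3)
        - ?v $ 2 * (?u $ 1 * g (n - 2) $ 3 + ?v $ 1 * g (n - 1) $ 3)"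
    by (simp add: algebra_simps)
  then have "(?u $ 2 * ?v $ 1 - ?v $ 2 * ?u $ 1) * g (n - 2) $ 3 = 0"
    unfolding e1 e2 by simp
  then have g23: "g (n - 2) $ 3 = 0" using det by simp
  then have g13: "g (n - 1) $ 3 = 0" using e2 x by simp
  have "g (n - 2) = 0" "g (n - 1) = 0"
    using c g12 g13 g23 by (simp_all add: Finite_Cartesian_Product.vec_eq_iff forall_3)
  with g0[of i] i s show ?thesis by auto
qed

theorem theorem11:
  fixes n :: nat and m :: "nat \<Rightarrow> real" and q :: "nat \<Rightarrow> real^3"
  assumes "n \<ge> 3"
    and "nCC n m q"
    and "q (n - 1) $ 2 = 0" and "q (n - 1) $ 3 = 0" and "q (n - 2) $ 3 = 0"
    and "q (n - 1) $ 1 - q n $ 1 \<noteq> 0"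
    and "q (n - 1) $ 1 \<noteq> 0"
    and "q (n - 2) $ 2 \<noteq> 0"
    and "Determinants.det (vector
           [vector [q (n - 2) $ 2 - q n $ 2, q (n - 1) $ 2 - q n $ 2],
            vector [q (n - 2) $ 1 - q n $ 1, q (n - 1) $ 1 - q n $ 1]] :: real^2^2) \<noteq> 0"
  shows "nondegenerate_nCC n m q \<longleftrightarrow> nondegenerate_RS_solution n m q"
proof -
  note n = assms(1) and a = assms(3,4,7) and b = assms(5,8)
  have conf: "configuration n m q" and inj: "inj_on q {1..n}"
    and F0: "\<And>i. i \<in> {1..n} \<Longrightarrow> F n m q i = 0"
    using assms(2) by (auto simp: nCC_def configuration_def)
  have "m n > 0" using conf n unfolding configuration_def by (meson atLeastAtMost_iff order.refl order.trans one_le_numeral)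
  then have m: "m n \<noteq> 0" by simp
  have ab: "n - 1 \<in> {1..n}" "n - 2 \<in> {1..n}" using n by auto
  have q: "q n = com_position n m q"
    using com_position_eq_iff[of n m q] nCC_center_of_mass[OF F0] n m by simp
  have RS: "RS_solution n m q"
  proof -
    have "Fred n m q i = F n m q i" for i
      using q by (simp add: Fred_def fun_upd_idem)
    moreover have "i \<in> {1..n}" if "(i, k) \<in> set (RS_coords n)" for i k
      using that n by (auto simp: set_RS_coords)
    ultimately show ?thesis unfolding RS_solution_def using conf F0 assms q by fastforce
  qed
  have det: "(q (n - 2) $ 2 - q n $ 2) * (q (n - 1) $ 1 - q n $ 1)
       \<noteq> (q (n - 1) $ 2 - q n $ 2) * (q (n - 2) $ 1 - q n $ 1)"
    using assms(9) by (simp add: det_2)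
  let ?D = "F_deriv n m q"
  have kernel: "?D w i = 0"
    if com: "(\<Sum>i\<in>{1..n}. m i *\<^sub>R w i) = 0" and "\<forall>(i, k)\<in>set (RS_coords n). ?D w i $ k = 0" and i: "i \<in> {1..n}" for w i
  proof -
    have "m i *\<^sub>R ?D w i = 0"
    proof (rule balanced_forces_vanish[OF n _ _ _ assms(6) det i])
      show "(\<Sum>i\<in>{1..n}. m i *\<^sub>R ?D w i) = 0" using F_deriv_momentum com by simp
      show "(\<Sum>i\<in>{1..n}. q i \<times> (m i *\<^sub>R ?D w i)) = 0"
        using F_deriv_angular_momentum[OF F0] by (simp add: cross_mult_right)
      show "\<forall>(i, k)\<in>set (RS_coords n). (m i *\<^sub>R ?D w i) $ k = 0" using that(2) by auto
    qed
    moreover have "m i > 0" using conf i by (simp add: configuration_def)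
    ultimately show ?thesis by simp
  qed
  have com: "(\<Sum>i\<in>{1..n}. m i *\<^sub>R w i) = 0" if "\<forall>i\<in>{1..n}. ?D w i = 0" for w
    using F_deriv_momentum[of m n q w] that by simp
  have "(\<forall>w. (\<forall>i\<in>{1..n}. ?D w i = 0) \<longrightarrow> (\<exists>\<omega>. \<forall>i\<in>{1..n}. w i = \<omega> \<times> q i)) \<longleftrightarrow>
      (\<forall>w. w (n - 2) $ 3 = 0 \<and> w (n - 1) $ 2 = 0 \<and> w (n - 1) $ 3 = 0
         \<and> (\<Sum>i\<in>{1..n}. m i *\<^sub>R w i) = 0
         \<and> (\<forall>(i, k)\<in>set (RS_coords n). ?D w i $ k = 0)
       \<longrightarrow> (\<forall>i\<in>{1..n}. w i = 0))" (is "?L \<longleftrightarrow> ?R")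
  proof
    assume L: ?L
    show ?R
    proof (intro allI impI, elim conjE)
      fix w
      assume gauge: "w (n - 2) $ 3 = 0" "w (n - 1) $ 2 = 0" "w (n - 1) $ 3 = 0"
        and "(\<Sum>i\<in>{1..n}. m i *\<^sub>R w i) = 0" "\<forall>(i, k)\<in>set (RS_coords n). ?D w i $ k = 0"
      with L kernel obtain \<omega> where \<omega>: "\<forall>i\<in>{1..n}. w i = \<omega> \<times> q i" by blast
      then have "\<omega> = 0" using rotation_gauge_unique[OF a b, of \<omega>] gauge ab by simp
      then show "\<forall>i\<in>{1..n}. w i = 0" using \<omega> by simp
    qed
  next
    assume R: ?R
    show ?L
    proof (intro allI impI)
      fix w assume w: "\<forall>i\<in>{1..n}. ?D w i = 0"
      obtain \<omega> where \<omega>: "(\<omega> \<times> q (n - 1)) $ 2 = w (n - 1) $ 2" "(\<omega> \<times> q (n - 1)) $ 3 = w (n - 1) $ 3"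
        "(\<omega> \<times> q (n - 2)) $ 3 = w (n - 2) $ 3"
        using rotation_gauge_exists[OF a b] by blast
      \<comment> \<open>Subtracting a rotation moves \<open>w\<close> into the complement of the infinitesimal rotations.\<close>
      define u where "u = (\<lambda>i. w i + (- \<omega>) \<times> q i)"
      have u: "?D u i = 0" if "i \<in> {1..n}" for i
        unfolding u_def F_deriv_add F_deriv_rotation using w F0 that by simp
      then have "\<forall>(i, k)\<in>set (RS_coords n). ?D u i $ k = 0"
        using n by (auto simp: set_RS_coords)
      moreover have "u (n - 2) $ 3 = 0" "u (n - 1) $ 2 = 0" "u (n - 1) $ 3 = 0"
        using \<omega> by (simp_all add: u_def)
      ultimately have "\<forall>i\<in>{1..n}. u i = 0" using R com u by blast
      then show "\<exists>\<omega>. \<forall>i\<in>{1..n}. w i = \<omega> \<times> q i"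
        by (intro exI[of _ \<omega>]) (simp add: u_def)
    qed
  qed
  then show ?thesis
    using nondegenerate_nCC_iff[OF assms(2) ab a b] RS_jacobian_invertible_iff[OF n inj q m] RS
    by (simp add: nondegenerate_RS_solution_def)
qed

end
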